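(* Let $A\in\mathbb{R}^{n\times n}$ be a symmetric positive definite matrix, let $1\le i\le N$, and let $\widetilde{\Omega}_i$ be the $i$-th extended overlapping subdomain. Let $\widetilde{C}_i\in\mathbb{R}^{n\times n}$ be a local SPSD splitting of $C=A^2$ with respect to the extended overlapping subdomain $\widetilde{\Omega}_i$, and let $\underline{\widetilde{A}}_i\in\mathbb{R}^{n\times n}$ be the symmetric positive semi-definite square root of $\widetilde{C}_i$, i.e., the SPSD matrix such that $\underline{\widetilde{A}}_i^2=\widetilde{C}_i$. Then $\underline{\widetilde{A}}_i$ is a local SPSD splitting of $A$ with respect to the extended overlapping subdomain $\widetilde{\Omega}_i$.
   Context: SPD means symmetric positive definite and SPSD means symmetric positive semi-definite. $I_n$ is the identity matrix of size $n$. For an ordered set of indices $S\subset\{1,\dots,n\}$, $I_n(S,:)$ is the submatrix of $I_n$ formed by the rows with indices in $S$ (in the given order); $[S_1,S_2]$ denotes concatenation of index sets. Subdomains: let $\mathcal{G}(A)$ be the adjacency graph of $A$, with nodes $\{1,\dots,n\}$. The nodes are partitioned into $N$ disjoint subsets $\Omega_{I1},\dots,\Omega_{IN}$ (nonoverlapping subdomains). For each $i$, $\Omega_{\Gamma i}$ is the set of nodes at distance one in $\mathcal{G}(A)$ from the nodes in $\Omega_{Ii}$ (not in $\Omega_{Ii}$), and $\Omega_{\Delta i}$ is the set of nodes that are not in $\Omega_{Ii}$ (nor in $\Omega_{\Gamma i}$) and are at distance one in $\mathcal{G}(A)$ from the nodes in $\Omega_{\Gamma i}$. The extended overlapping subdomain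 is $\widetilde{\Omega}_i=[\Omega_{Ii},\Omega_{\Gamma i},\Omega_{\Delta i}]$, and $\Omega_{\mathrm{c}_\Delta i}$ denotes its complement in $\{1,\dots,n\}$. Local SPSD splitting: given an SPD matrix $M\in\mathbb{R}^{n\times n}$, a local SPSD splitting of $M$ with respect to the extended overlapping subdomain $\widetilde{\Omega}_i$ is any SPSD matrix $\widetilde{M}_i\in\mathbb{R}^{n\times n}$ such that $0\le u^\top\widetilde{M}_iu\le u^\top Mu$ for all $u\in\mathbb{R}^n$, and $I_n(\Omega_{\mathrm{c}_\Delta i},:)\,\widetilde{M}_i=0$ (all rows of $\widetilde{M}_i$ indexed outside $\widetilde{\Omega}_i$ vanish). *)

theory Defs
  imports "HOL-Analysis.Analysis"
begin

definition spd :: "real^'n^'n \<Rightarrow> bool" where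
  "spd M \<longleftrightarrow> transpose M = M \<and> (\<forall>u. u \<noteq> 0 \<longrightarrow> 0 < u \<bullet> (M *v u))"

definition spsd :: "real^'n^'n \<Rightarrow> bool" where
  "spsd M \<longleftrightarrow> transpose M = M \<and> (\<forall>u. 0 \<le> u \<bullet> (M *v u))"

text \<open>The nodes are all elements of the index type, so the graph is given by its
  edge relation, which is symmetric whenever the matrix is. Diagonal entries do not
  create loops.\<close>

definition adjacency_graph :: "real^'n^'n \<Rightarrow> ('n \<times> 'n) set" where
  "adjacency_graph A = {(j, k). j \<noteq> k \<and> A $ j $ k \<noteq> 0}"

definition nonoverlapping_subdomains :: "nat \<Rightarrow> (nat \<Rightarrow> 'n set) \<Rightarrow> bool" where
  "nonoverlapping_subdomains N \<Omega> \<longleftrightarrow>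
     disjoint_family_on \<Omega> {1..N} \<and> (\<Union>i\<in>{1..N}. \<Omega> i) = UNIV"

text \<open>In the next three definitions \<open>S\<close> is a nonoverlapping subdomain
  \<open>\<Omega>\<^sub>I\<^sub>i\<close>; the results are \<open>\<Omega>\<^sub>\<Gamma>\<^sub>i\<close>, \<open>\<Omega>\<^sub>\<Delta>\<^sub>i\<close>
  and the extended overlapping subdomain. Two nodes are at distance one exactly when
  they are joined by an edge.\<close>

definition omega_Gamma :: "real^'n^'n \<Rightarrow> 'n set \<Rightarrow> 'n set" where
  "omega_Gamma A S = {k. k \<notin> S \<and> (\<exists>j\<in>S. (j, k) \<in> adjacency_graph A)}"

definition omega_Delta :: "real^'n^'n \<Rightarrow> 'n set \<Rightarrow> 'n set" where
  "omega_Delta A S = {k. k \<notin> S \<and> k \<notin> omega_Gamma A S \<and>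
     (\<exists>j\<in>omega_Gamma A S. (j, k) \<in> adjacency_graph A)}"

definition extended_subdomain :: "real^'n^'n \<Rightarrow> 'n set \<Rightarrow> 'n set" where
  "extended_subdomain A S = S \<union> omega_Gamma A S \<union> omega_Delta A S"

text \<open>\<open>local_spsd_splitting M W M'\<close>: the matrix \<open>M'\<close> is a local SPSD splitting of
  \<open>M\<close> with respect to the index set \<open>W\<close>; it is meant for SPD \<open>M\<close>. The last conjunct
  says row by row that \<open>I(- W, :) M' = 0\<close>, where \<open>I(- W, :)\<close> consists of the rows of
  the identity with indices outside \<open>W\<close>; the order of these rows is immaterial.\<close>

definition local_spsd_splitting :: "real^'n^'n \<Rightarrow> 'n set \<Rightarrow> real^'n^'n \<Rightarrow> bool" where
  "local_spsd_splitting M W M' \<longleftrightarrow>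
     spsd M' \<and>
     (\<forall>u. 0 \<le> u \<bullet> (M' *v u) \<and> u \<bullet> (M' *v u) \<le> u \<bullet> (M *v u)) \<and>
     (\<forall>k \<in> - W. row k (mat 1 :: real^'n^'n) v* M' = 0)"

end

theory Submission
  imports Defs
begin

text \<open>Write \<open>B\<close> for the positive semi-definite square root of the splitting of \<open>A\<^sup>2\<close>. The
  support condition passes from \<open>B\<^sup>2\<close> to \<open>B\<close> because
  \<open>\<parallel>B x\<parallel>\<^sup>2 = x \<bullet> B\<^sup>2 x\<close>, so \<open>B\<close> and \<open>B\<^sup>2\<close> have the same kernel
  (\<open>symmetric_square_kernel\<close>); applied to the basis vectors with index outside the extended
  subdomain, this makes the corresponding rows of \<open>B\<close> vanish.

  The upper bound is the operator monotonicity of the square root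
  (\<open>spsd_sqrt_monotone\<close>): \<open>B\<^sup>2 \<le> A\<^sup>2\<close> implies \<open>B \<le> A\<close>. If it failed, the
  least eigenvalue \<open>\<mu>\<close> of \<open>A - B\<close> would be negative. A corresponding eigenvector \<open>v\<close> then satisfies
  \<open>B v = A v - \<mu> v\<close>, so
  \<open>\<parallel>B v\<parallel>\<^sup>2 = \<parallel>A v\<parallel>\<^sup>2 - 2 \<mu> (v \<bullet> A v) + \<mu>\<^sup>2 \<parallel>v\<parallel>\<^sup>2 > \<parallel>A v\<parallel>\<^sup>2\<close>,
  because \<open>\<mu> < 0 \<le> v \<bullet> A v\<close>, which contradicts
  \<open>v \<bullet> B\<^sup>2 v \<le> v \<bullet> A\<^sup>2 v\<close>.\<close>

lemma symmetric_inner_move: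
  fixes E :: "real^'n^'n"
  assumes "transpose E = E"
  shows "x \<bullet> (E *v y) = (E *v x) \<bullet> y"
  by (metis assms dot_lmul_matrix vector_transpose_matrix)

lemma symmetric_square_form:
  fixes E :: "real^'n^'n"
  assumes "transpose E = E"
  shows "x \<bullet> ((E ** E) *v x) = (E *v x) \<bullet> (E *v x)"
  by (simp add: symmetric_inner_move[OF assms, symmetric] matrix_vector_mul_assoc)

lemma symmetric_square_kernel:
  fixes B :: "real^'n^'n"
  assumes sym: "transpose B = B" and zero: "x v* (B ** B) = 0"
  shows "x v* B = 0"
proof -
  have "(B *v x) \<bullet> (B *v x) = (x v* (B ** B)) \<bullet> x"
    by (simp add: symmetric_square_form[OF sym, symmetric] dot_lmul_matrix)
  then have "B *v x = 0"
    using zero by simp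
  then show ?thesis
    by (metis sym vector_transpose_matrix)
qed

text \<open>A zero of a nonnegative quadratic form is a minimum, so the gradient \<open>2 E v\<close> vanishes
  there.\<close>

lemma spsd_isotropic_imp_kernel:
  fixes E :: "real^'n^'n"
  assumes "spsd E" and iso: "v \<bullet> (E *v v) = 0"
  shows "E *v v = 0"
proof (rule ccontr)
  assume nz: "E *v v \<noteq> 0"
  have sym: "transpose E = E" and nonneg: "\<And>u. 0 \<le> u \<bullet> (E *v u)"
    using assms by (auto simp: spsd_def)
  define w where "w = E *v v"
  define a where "a = w \<bullet> w"
  define q where "q = w \<bullet> (E *v w)"
  \<comment> \<open>A descent step from \<open>v\<close> along the gradient, short enough to make the form negative.\<close>
  define t where "t = - a / (q + 1)"
  have a: "a > 0" and q: "q \<ge> 0"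
    using nz nonneg by (simp_all add: a_def w_def q_def)
  have "v \<bullet> (E *v w) = a"
    by (simp add: symmetric_inner_move[OF sym] a_def w_def)
  moreover have "v \<bullet> w = 0"
    using iso by (simp add: w_def)
  ultimately have "(v + t *\<^sub>R w) \<bullet> (E *v (v + t *\<^sub>R w)) = 2 * t * a + t\<^sup>2 * q"
    by (simp add: matrix_vector_right_distrib matrix_vector_mult_scaleR inner_add_left
        inner_add_right w_def[symmetric] a_def[symmetric] q_def[symmetric] power2_eq_square
        algebra_simps)
  also have "\<dots> = - (a\<^sup>2 * (q + 2) / (q + 1)\<^sup>2)"
    using q unfolding t_def
    by (simp add: divide_simps power2_eq_square) (simp add: algebra_simps)
  also have "\<dots> < 0"
    using a q by simp
  finally show False
    using nonneg[of "v + t *\<^sub>R w"] by simp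
qed

text \<open>The quadratic form attains its minimum \<open>\<mu>\<close> on the compact unit sphere; subtracting
  \<open>\<mu>\<close> from the diagonal makes the minimizer a zero of a nonnegative form.\<close>

lemma symmetric_least_eigenvector:
  fixes D :: "real^'n^'n"
  assumes sym: "transpose D = D"
  obtains \<mu> v where "norm v = 1" "D *v v = \<mu> *\<^sub>R v"
    "\<And>u. \<mu> * (u \<bullet> u) \<le> u \<bullet> (D *v u)"
proof -
  have "continuous_on (sphere 0 1) (\<lambda>u :: real^'n. u \<bullet> (D *v u))"
    by (intro continuous_intros)
  moreover have "sphere (0 :: real^'n) 1 \<noteq> {}"
    by simp
  ultimately have "\<exists>v \<in> sphere (0 :: real^'n) 1.
      \<forall>u \<in> sphere 0 1. v \<bullet> (D *v v) \<le> u \<bullet> (D *v u)"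
    by (intro continuous_attains_inf compact_sphere)
  then obtain v :: "real^'n" where v: "norm v = 1"
    and min: "\<And>u. norm u = 1 \<Longrightarrow> v \<bullet> (D *v v) \<le> u \<bullet> (D *v u)"
    by auto
  define \<mu> where "\<mu> = v \<bullet> (D *v v)"
  have bound: "\<mu> * (u \<bullet> u) \<le> u \<bullet> (D *v u)" for u
  proof (cases "u = 0")
    case False
    define w where "w = u /\<^sub>R norm u"
    have u: "u = norm u *\<^sub>R w" and w: "norm w = 1"
      using False by (simp_all add: w_def)
    have "u \<bullet> (D *v u) = (norm u)\<^sup>2 * (w \<bullet> (D *v w))"
      by (subst (1 2) u) (simp add: matrix_vector_mult_scaleR power2_eq_square)
    moreover have "(norm u)\<^sup>2 * \<mu> \<le> (norm u)\<^sup>2 * (w \<bullet> (D *v w))"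
      using min[OF w] by (simp add: \<mu>_def mult_left_mono)
    ultimately show ?thesis
      by (simp add: power2_norm_eq_inner mult.commute)
  qed simp
  define E where "E = D - \<mu> *\<^sub>R mat 1"
  have E: "E *v u = D *v u - \<mu> *\<^sub>R u" for u
    by (simp add: E_def matrix_vector_mult_diff_rdistrib scaleR_matrix_vector_assoc[symmetric])
  have "transpose E = E"
    using sym by (auto simp: E_def transpose_def vec_eq_iff mat_def)
  then have "spsd E"
    using bound by (simp add: spsd_def E inner_diff_right)
  moreover have "v \<bullet> (E *v v) = 0"
    using v by (simp add: E inner_diff_right \<mu>_def dot_square_norm)
  ultimately have "E *v v = 0"
    by (rule spsd_isotropic_imp_kernel)
  then show thesis
    using that[OF v _ bound] by (simp add: E)
qed

text \<open>The case of exponent one half of the Loewner--Heinz inequality.\<close>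

lemma spsd_sqrt_monotone:
  fixes A B :: "real^'n^'n"
  assumes A: "spsd A" and B: "spsd B"
    and le: "\<And>u. u \<bullet> ((B ** B) *v u) \<le> u \<bullet> ((A ** A) *v u)"
  shows "u \<bullet> (B *v u) \<le> u \<bullet> (A *v u)"
proof -
  have symA: "transpose A = A" and symB: "transpose B = B"
    using A B by (auto simp: spsd_def)
  have "transpose (A - B) = A - B"
    using symA symB by (simp add: transpose_def vec_eq_iff)
  then obtain v \<mu> where v: "norm v = 1" and eig: "(A - B) *v v = \<mu> *\<^sub>R v"
    and bound: "\<And>u. \<mu> * (u \<bullet> u) \<le> u \<bullet> ((A - B) *v u)"
    using symmetric_least_eigenvector by blast
  have "\<mu> \<ge> 0"
  proof (rule ccontr)
    assume "\<not> \<mu> \<ge> 0"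
    then have neg: "\<mu> < 0" by simp
    have Bv: "B *v v = A *v v - \<mu> *\<^sub>R v"
      using eig by (simp add: matrix_vector_mult_diff_rdistrib algebra_simps)
    have "v \<bullet> v = 1"
      using v by (simp add: dot_square_norm)
    then have "(B *v v) \<bullet> (B *v v)
        = (A *v v) \<bullet> (A *v v) - 2 * \<mu> * (v \<bullet> (A *v v)) + \<mu>\<^sup>2"
      by (simp add: Bv inner_diff_left inner_diff_right inner_commute[of "A *v v" v]
          power2_eq_square right_diff_distrib)
    moreover have "\<mu> * (v \<bullet> (A *v v)) \<le> 0"
      using neg A by (simp add: spsd_def mult_nonpos_nonneg)
    moreover have "\<mu>\<^sup>2 > 0"
      using neg by simp
    ultimately have "(B *v v) \<bullet> (B *v v) > (A *v v) \<bullet> (A *v v)"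
      by linarith
    with le[of v] show False
      by (simp add: symmetric_square_form symA symB)
  qed
  then have "0 \<le> \<mu> * (u \<bullet> u)"
    by simp
  also note bound[of u]
  finally show ?thesis
    by (simp add: matrix_vector_mult_diff_rdistrib inner_diff_right)
qed

lemma spd_imp_spsd: "spd M \<Longrightarrow> spsd M"
  unfolding spd_def spsd_def by (metis inner_zero_left less_imp_le order_refl)

theorem lemma3p2:
  fixes A C Ct At :: "real^'n^'n"
    and N i :: nat
    and \<Omega>I :: "nat \<Rightarrow> 'n set"
  assumes "spd A"
    and "nonoverlapping_subdomains N \<Omega>I"
    and "1 \<le> i" and "i \<le> N"
    and "C = A ** A"
    and "local_spsd_splitting C (extended_subdomain A (\<Omega>I i)) Ct"
    and "spsd At" and "At ** At = Ct"
  shows "local_spsd_splitting A (extended_subdomain A (\<Omega>I i)) At"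
proof -
  have le: "u \<bullet> ((At ** At) *v u) \<le> u \<bullet> ((A ** A) *v u)" for u
    using assms(5,6,8) by (simp add: local_spsd_splitting_def)
  have "u \<bullet> (At *v u) \<le> u \<bullet> (A *v u)" for u
    using spd_imp_spsd[OF \<open>spd A\<close>] \<open>spsd At\<close> le by (rule spsd_sqrt_monotone)
  moreover have "row k (mat 1 :: real^'n^'n) v* At = 0"
    if "k \<in> - extended_subdomain A (\<Omega>I i)" for k
  proof (rule symmetric_square_kernel)
    show "transpose At = At"
      using \<open>spsd At\<close> by (simp add: spsd_def)
    show "row k (mat 1 :: real^'n^'n) v* (At ** At) = 0"
      using that assms(6,8) unfolding local_spsd_splitting_def by blast
  qed
  ultimately show ?thesis
    using \<open>spsd At\<close> by (auto simp: local_spsd_splitting_def spsd_def)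
qed

end
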